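(* Let $\mathbb{L},\mathbb{B}$ be continuous complete lattices with join bases $J_{\mathbb{L}},J_{\mathbb{B}}$ such that $\bot\notin J_{\mathbb{L}}$, $\bot\notin J_{\mathbb{B}}$ and $J_{\mathbb{B}}$ consists only of way-below irreducible elements; let $\alpha\dashv\gamma$ be a Galois connection with $\alpha\colon\mathbb{L}\to\mathbb{B}$, and let $\lambda\colon\mathbb{L}\to\mathbb{L}$, $\beta\colon\mathbb{B}\to\mathbb{B}$ be monotone with $\alpha\circ\lambda=\beta\circ\alpha$. Assume $\beta$ is Scott-continuous and let $S$ be a finitary winning strategy for $\exists$ in the primal way-below game on $\beta$, i.e. $S$ assigns to every $b\in J_{\mathbb{B}}$ with $b\ll\mu\beta$ a finite set $S(b)\subseteq J_{\mathbb{B}}$ with $b\ll\beta(\bigsqcup S(b))$ and $\deg_\beta(b')<\deg_\beta(b)$ for all $b'\in S(b)$. For $b\in J_{\mathbb{B}}$ and finite $A\subseteq J_{\mathbb{L}}$ with $b\ll\alpha(\lambda(\bigsqcup A))$ let $P(b,A)$ denote a chosen element $a\in J_{\mathbb{L}}$ with $a\ll\lambda(\bigsqcup A)$ and $b\ll\alpha(a)$. Then for every $b\in J_{\mathbb{B}}$ with $b\ll\mu\beta$, the recursion $$\mathit{wit}(b)=P\big(b,\{\mathit{wit}(b')\mid b'\in S(b)\}\big)$$ is a well-defined inductive definition with base case $S(b)=\emptyset$, it yields a primal witness $\mathit{wit}(b)$ for $b$, and $\deg_\lambda(\mathit{wit}(b))\le\deg_\beta(b)$.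
   Context: Galois connection: monotone $\alpha,\gamma$ with $\ell\sqsubseteq\gamma\alpha(\ell)$ and $\alpha\gamma(d)\sqsubseteq d$. $\mu f$: least fixpoint. $x\ll y$: for every directed $D$ with $y\sqsubseteq\bigsqcup D$ there is $d\in D$ with $x\sqsubseteq d$. Continuous lattice: $\ell=\bigsqcup\{\ell'\mid\ell'\ll\ell\}$. Join basis $J$: $\ell=\bigsqcup\{b\in J\mid b\sqsubseteq\ell\}$. Way-below irreducible $b$: $b\ll\bigsqcup F$ with $F$ finite implies $b\ll f$ for some $f\in F$. Scott-continuous: preserves directed joins. Kleene iterates $f^i(\bot)$ over ordinals; degree $\deg_f(x)=\min\{i\mid x\ll f^i(\bot)\}$. Primal witness for $b$: $a\in\mathbb{L}$ with $a\ll\mu\lambda$ and $b\ll\alpha(a)$. Primal way-below game on $\beta$: at $b\in J_{\mathbb{B}}$, $\exists$ chooses $d$ with $b\ll\beta(d)$; at $d$, $\forall$ chooses $b'\in J_{\mathbb{B}}$ with $b'\ll d$; a player unable to move loses; infinite plays are won by $\forall$. *)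

theory Defs
  imports Main
begin

section \<open>Continuous lattices\<close>

definition (in order) directed :: "'a set \<Rightarrow> bool" where
  "directed D \<longleftrightarrow> D \<noteq> {} \<and> (\<forall>x\<in>D. \<forall>y\<in>D. \<exists>z\<in>D. x \<le> z \<and> y \<le> z)"

definition (in complete_lattice) way_below :: "'a \<Rightarrow> 'a \<Rightarrow> bool" (infix \<open>\<lless>\<close> 50) where
  "x \<lless> y \<longleftrightarrow> (\<forall>D. directed D \<longrightarrow> y \<le> Sup D \<longrightarrow> (\<exists>d\<in>D. x \<le> d))"

class continuous_lattice = complete_lattice +
  assumes Sup_way_below: "x = Sup {y. y \<lless> x}"

definition join_basis :: "'a::complete_lattice set \<Rightarrow> bool" where
  "join_basis J \<longleftrightarrow> (\<forall>x. x = Sup {b \<in> J. b \<le> x})"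

definition way_below_irreducible :: "'a::complete_lattice \<Rightarrow> bool" where
  "way_below_irreducible b \<longleftrightarrow> (\<forall>F. finite F \<longrightarrow> b \<lless> Sup F \<longrightarrow> (\<exists>f\<in>F. b \<lless> f))"

definition scott_continuous :: "('a::complete_lattice \<Rightarrow> 'b::complete_lattice) \<Rightarrow> bool" where
  "scott_continuous f \<longleftrightarrow> (\<forall>D. directed D \<longrightarrow> f (Sup D) = Sup (f ` D))"

definition galois_connection :: "('l::order \<Rightarrow> 'b::order) \<Rightarrow> ('b \<Rightarrow> 'l) \<Rightarrow> bool" where
  "galois_connection \<alpha> \<gamma> \<longleftrightarrow>
     mono \<alpha> \<and> mono \<gamma> \<and> (\<forall>l. l \<le> \<gamma> (\<alpha> l)) \<and> (\<forall>d. \<alpha> (\<gamma> d) \<le> d)"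


section \<open>Ordinals\<close>

text \<open>
  The ordinals of cardinality at most that of \<^typ>\<open>'a\<close>: order types of the
  well-orders whose field is a subset of \<^typ>\<open>'a\<close>.
\<close>

quotient_type 'a ordinal = "'a rel" / partial: "\<lambda>r s. (r, s) \<in> ordIso"
proof (rule part_equivpI)
  show "\<exists>r :: 'a rel. (r, r) \<in> ordIso"
    using ordIso_reflexive[of "{} :: 'a rel"] by (auto simp: well_order_on_def)
  show "symp (\<lambda>r s :: 'a rel. (r, s) \<in> ordIso)"
    by (blast intro: sympI ordIso_symmetric)
  show "transp (\<lambda>r s :: 'a rel. (r, s) \<in> ordIso)"
    by (blast intro: transpI ordIso_transitive)
qed

instantiation ordinal :: (type) wellorder
begin

lift_definition less_eq_ordinal :: "'a ordinal \<Rightarrow> 'a ordinal \<Rightarrow> bool"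
  is "\<lambda>r s. (r, s) \<in> ordLeq"
  by (meson ordIso_iff_ordLeq ordLeq_transitive)

lift_definition less_ordinal :: "'a ordinal \<Rightarrow> 'a ordinal \<Rightarrow> bool"
  is "\<lambda>r s. (r, s) \<in> ordLess"
  by (meson ordIso_symmetric ordIso_ordLess_trans ordLess_ordIso_trans)

lemma Well_order_refl_ordIso: "(r, r) \<in> ordIso \<longleftrightarrow> Well_order r"
  using ordIso_reflexive by (auto simp: ordIso_def)

instance
proof
  fix x y z :: "'a ordinal"
  show "x < y \<longleftrightarrow> x \<le> y \<and> \<not> y \<le> x"
    by transfer (meson Well_order_refl_ordIso not_ordLeq_iff_ordLess ordLess_imp_ordLeq)
  show "x \<le> x"
    by transfer (simp add: ordIso_imp_ordLeq)
  show "x \<le> y \<Longrightarrow> y \<le> z \<Longrightarrow> x \<le> z"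
    by transfer (rule ordLeq_transitive)
  show "x \<le> y \<Longrightarrow> y \<le> x \<Longrightarrow> x = y"
    by transfer (simp add: ordIso_iff_ordLeq)
  show "x \<le> y \<or> y \<le> x"
    by transfer (simp add: Well_order_refl_ordIso ordLeq_total)
next
  fix P :: "'a ordinal \<Rightarrow> bool" and x
  assume step: "\<And>x. (\<And>y. y < x \<Longrightarrow> P y) \<Longrightarrow> P x"
  have "Quotient3 (\<lambda>r s. (r, s) \<in> ordIso) abs_ordinal (rep_ordinal :: 'a ordinal \<Rightarrow> _)"
    by (rule Quotient3_ordinal)
  then have less: "x < y \<longleftrightarrow> (rep_ordinal x, rep_ordinal y) \<in> ordLess" for x y :: "'a ordinal"
    by (simp add: less_ordinal_def map_fun_def)
  have "wf (inv_image ordLess (rep_ordinal :: 'a ordinal \<Rightarrow> _))"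
    by (intro wf_inv_image wf_ordLess)
  then show "P x"
    by (induction x rule: wf_induct_rule) (auto intro: step simp: less)
qed

end

text \<open>There are more ordinals of cardinality at most that of \<^typ>\<open>'a\<close> than elements of \<^typ>\<open>'a\<close>.\<close>

lemma rep_ordinal_less: "x < y \<longleftrightarrow> (rep_ordinal x, rep_ordinal y) \<in> ordLess"
  by (simp add: less_ordinal_def map_fun_def)

lemma Well_order_rep_ordinal: "Well_order (rep_ordinal x)"
  using Quotient3_rep_reflp[OF Quotient3_ordinal] by (simp add: Well_order_refl_ordIso)

lemma rep_abs_ordinal: "Well_order r \<Longrightarrow> (rep_ordinal (abs_ordinal r), r) \<in> ordIso"
  using rep_abs_rsp_left[OF Quotient3_ordinal] ordIso_reflexive by blast

lemma not_inj_ordinal: "\<not> inj (g :: 'a ordinal \<Rightarrow> 'a)"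
proof
  assume g: "inj g"
  define R where "R = {(g x, g y) | x y. x \<le> y}"
  have R: "(g x, g y) \<in> R \<longleftrightarrow> x \<le> y" for x y
    by (auto simp: R_def inj_eq[OF g])
  have field: "Field R = range g"
    by (auto simp: R_def Field_def)
  have strict: "R - Id = {(g x, g y) | x y. x < y}"
    by (auto simp: R_def inj_eq[OF g] order_less_le)
  have "wf (R - Id)"
    unfolding wf_def
  proof (intro allI impI)
    fix P z
    assume H: "\<forall>x. (\<forall>y. (y, x) \<in> R - Id \<longrightarrow> P y) \<longrightarrow> P x"
    have "P (g x)" for x
    proof (induction x rule: less_induct)
      case (less x)
      then show ?case
        using H g unfolding strict by (blast dest: injD)
    qed
    then show "P z"
      using H unfolding strict by blast
  qed
  moreover have "refl_on (range g) R" "trans R" "antisym R" "total_on (range g) R"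
    by (auto simp: R field refl_on_def total_on_def)
      (auto simp: R_def inj_eq[OF g] intro!: transI antisymI)
  ultimately have wo: "Well_order R"
    unfolding well_order_on_def linear_order_on_def partial_order_on_def preorder_on_def field
    by (auto simp: R_def)
  define seg where "seg x = Restr R (underS R (g x))" for x
  have under: "underS R (g x) = g ` {y. y < x}" for x
    by (auto simp: underS_def R_def inj_eq[OF g] order_less_le)
  have wo_seg: "Well_order (seg x)" for x
    unfolding seg_def using wo by (rule Well_order_Restr)
  have field_seg: "Field (seg x) = g ` {y. y < x}" for x
  proof
    show "Field (seg x) \<subseteq> g ` {y. y < x}"
      unfolding seg_def under Field_def by blast
    show "g ` {y. y < x} \<subseteq> Field (seg x)"
      using R[of y y for y] unfolding seg_def under Field_def by blast
  qed
  have seg_seg: "Restr (seg x) (underS (seg x) (g y)) = seg y" if "y < x" for x y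
  proof -
    have "(u, g y) \<in> R \<longleftrightarrow> u \<in> g ` {z. z \<le> y}" for u
      by (auto simp: R_def inj_eq[OF g])
    then have "underS (seg x) (g y) = g ` {z. z < y}"
      using that unfolding seg_def under
      by (auto simp: underS_def inj_eq[OF g] order_less_le intro: order_trans)
    then show ?thesis
      using that by (auto simp: seg_def under R inj_eq[OF g])
  qed
  have seg_mono: "(seg y, seg x) \<in> ordLess" if "y < x" for x y
    using underS_Restr_ordLess[OF wo_seg[of x], of "g y"] that field_seg[of x] seg_seg[OF that]
    by fastforce
  have seg_iso: "(seg x, rep_ordinal x) \<in> ordIso" for x
  proof (induction x rule: less_induct)
    case (less x)
    have "(seg x, rep_ordinal x) \<in> ordLeq"
      unfolding ordLeq_iff_ordLess_Restr[OF wo_seg Well_order_rep_ordinal]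
      using less by (auto simp: field_seg seg_seg rep_ordinal_less intro: ordIso_ordLess_trans)
    moreover have "(rep_ordinal x, seg x) \<in> ordLeq"
      unfolding ordLeq_iff_ordLess_Restr[OF Well_order_rep_ordinal wo_seg]
    proof
      fix a
      assume a: "a \<in> Field (rep_ordinal x)"
      let ?s = "Restr (rep_ordinal x) (underS (rep_ordinal x) a)"
      have s: "Well_order ?s"
        by (rule Well_order_Restr[OF Well_order_rep_ordinal])
      have "(?s, rep_ordinal x) \<in> ordLess"
        using a by (intro underS_Restr_ordLess Well_order_rep_ordinal) auto
      then have "abs_ordinal ?s < x"
        unfolding rep_ordinal_less by (rule ordIso_ordLess_trans[OF rep_abs_ordinal[OF s]])
      moreover have "(?s, seg (abs_ordinal ?s)) \<in> ordIso"
        using ordIso_transitive[OF less[OF calculation] rep_abs_ordinal[OF s]]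
        by (rule ordIso_symmetric)
      ultimately show "(?s, seg x) \<in> ordLess"
        using seg_mono ordIso_ordLess_trans by blast
    qed
    ultimately show ?case
      by (simp add: ordIso_iff_ordLeq)
  qed
  have "(seg (abs_ordinal R), R) \<in> ordIso"
    using seg_iso rep_abs_ordinal[OF wo] ordIso_transitive by blast
  moreover have "(seg (abs_ordinal R), R) \<in> ordLess"
    unfolding seg_def using wo by (rule underS_Restr_ordLess) (simp add: field)
  ultimately show False
    using not_ordLess_ordIso by blast
qed


section \<open>Kleene iterates and degrees\<close>

definition is_succ :: "'o::order \<Rightarrow> 'o \<Rightarrow> bool" where
  "is_succ j i \<longleftrightarrow> j < i \<and> \<not> (\<exists>k. j < k \<and> k < i)"

lemma is_succ_unique: "is_succ j i \<Longrightarrow> is_succ j' i \<Longrightarrow> j = (j' :: 'o::linorder)"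
  by (meson is_succ_def neqE)

lemma the_is_succ: "is_succ j i \<Longrightarrow> (THE j'. is_succ j' i) = (j :: 'o::linorder)"
  using is_succ_unique by blast

text \<open>
  \<open>kleene f i\<close> is the \<open>i\<close>-th iterate of \<open>f\<close> on \<open>bot\<close>; the join also covers \<open>i = 0\<close>, where it is empty.
\<close>

function kleene :: "('a::complete_lattice \<Rightarrow> 'a) \<Rightarrow> 'o::wellorder \<Rightarrow> 'a" where
  "kleene f i =
     (if \<exists>j. is_succ j i then f (kleene f (THE j. is_succ j i))
      else SUP j\<in>{..<i}. kleene f j)"
  by auto
termination
proof (relation "inv_image {(i, j). i < j} snd")
  fix f :: "'a \<Rightarrow> 'a" and i :: "'o::wellorder"
  assume "\<exists>j. is_succ j i"
  then show "((f, THE j. is_succ j i), (f, i)) \<in> inv_image {(i, j). i < j} snd"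
    by (auto simp: the_is_succ) (simp add: is_succ_def)
qed (auto intro: wf)

declare kleene.simps [simp del]

lemma kleene_succ: "is_succ j i \<Longrightarrow> kleene f i = f (kleene f j)"
  by (subst kleene.simps) (auto simp: the_is_succ)

lemma kleene_limit: "\<nexists>j. is_succ j i \<Longrightarrow> kleene f i = (SUP j\<in>{..<i}. kleene f j)"
  by (subst kleene.simps) auto

lemma kleene_increasing:
  fixes j :: "'o::wellorder"
  assumes f: "mono f"
  shows "kleene f j \<le> f (kleene f j) \<and> (\<forall>i<j. f (kleene f i) \<le> kleene f j)"
proof (induction j rule: less_induct)
  case (less j)
  show ?case
  proof (cases "\<exists>l. is_succ l j")
    case True
    then obtain l where l: "is_succ l j" by blast
    then have le: "i \<le> l" if "i < j" for i
      using that by (auto simp: is_succ_def not_less[symmetric])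
    have "l < j" using l by (simp add: is_succ_def)
    note IH = less.IH[OF this]
    have "f (kleene f i) \<le> f (kleene f l)" if "i < j" for i
    proof (cases "i = l")
      case False
      with le[OF that] have "i < l" by simp
      then show ?thesis
        using IH less.IH[OF that] f by (meson monoD order_trans)
    qed simp
    then show ?thesis
      using IH f by (simp add: kleene_succ[OF l] monoD)
  next
    case False
    then have lim: "kleene f j = (SUP k\<in>{..<j}. kleene f k)"
      by (rule kleene_limit)
    have upper: "kleene f k \<le> kleene f j" if "k < j" for k
      unfolding lim using that by (auto intro: SUP_upper)
    have "f (kleene f i) \<le> kleene f j" if i: "i < j" for i
    proof -
      obtain m where "i < m" "m < j"
        using False i unfolding is_succ_def by blast
      then show ?thesis
        using less.IH upper by (meson order_trans)
    qed
    moreover have "kleene f k \<le> f (kleene f j)" if "k < j" for k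
      using less.IH[OF that] upper[OF that] f by (meson monoD order_trans)
    then have "kleene f j \<le> f (kleene f j)"
      by (subst lim) (auto intro: SUP_least)
    ultimately show ?thesis by blast
  qed
qed

lemma kleene_le_lfp:
  assumes f: "mono f"
  shows "kleene f i \<le> lfp f"
proof (induction i rule: less_induct)
  case (less i)
  show ?case
  proof (cases "\<exists>j. is_succ j i")
    case True
    then obtain j where j: "is_succ j i" by blast
    then have "f (kleene f j) \<le> f (lfp f)"
      using less f by (intro monoD[OF f]) (auto simp: is_succ_def)
    then show ?thesis
      by (simp add: kleene_succ[OF j] lfp_fixpoint[OF f])
  next
    case False
    then show ?thesis
      by (subst kleene_limit) (auto intro: SUP_least less)
  qed
qed

text \<open>The iteration reaches the least fixpoint if there are enough ordinals.\<close>

lemma kleene_eq_lfp: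
  fixes f :: "'a::complete_lattice \<Rightarrow> 'a"
  assumes f: "mono f" and large: "\<nexists>g :: 'o::wellorder \<Rightarrow> 'a. inj g"
  shows "\<exists>i :: 'o. kleene f i = lfp f"
proof -
  obtain i j :: 'o where ij: "i < j" "kleene f i = kleene f j"
    using large by (metis injI neqE)
  then have "f (kleene f i) \<le> kleene f i"
    using kleene_increasing[OF f, of j] by auto
  then have "kleene f i = lfp f"
    by (intro antisym kleene_le_lfp[OF f] lfp_lowerbound)
  then show ?thesis ..
qed

text \<open>
  Ordinals that suffice for the Kleene iterations in two lattices \<^typ>\<open>'l\<close> and \<^typ>\<open>'b\<close>
  simultaneously; the summand \<^typ>\<open>nat\<close> provides all countable ordinals.
\<close>

type_synonym ('l, 'b) iteration_ordinal = "(nat + 'l + 'b) ordinal"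

lemma kleene_iteration_ordinal:
  fixes f :: "'l::complete_lattice \<Rightarrow> 'l" and g :: "'b::complete_lattice \<Rightarrow> 'b"
  assumes "mono f" and "mono g"
  shows "\<exists>i :: ('l, 'b) iteration_ordinal. kleene f i = lfp f"
    and "\<exists>i :: ('l, 'b) iteration_ordinal. kleene g i = lfp g"
proof -
  have "\<not> inj h" for h :: "('l, 'b) iteration_ordinal \<Rightarrow> 'l"
    using not_inj_ordinal[of "\<lambda>i. Inr (Inl (h i))"] by (auto simp: inj_def)
  then show "\<exists>i :: ('l, 'b) iteration_ordinal. kleene f i = lfp f"
    by (intro kleene_eq_lfp assms) blast
  have "\<not> inj h" for h :: "('l, 'b) iteration_ordinal \<Rightarrow> 'b"
    using not_inj_ordinal[of "\<lambda>i. Inr (Inr (h i))"] by (auto simp: inj_def)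
  then show "\<exists>i :: ('l, 'b) iteration_ordinal. kleene g i = lfp g"
    by (intro kleene_eq_lfp assms) blast
qed

text \<open>
  Only meaningful if \<open>x \<lless> kleene f i\<close> for some \<open>i\<close>; if the iteration reaches \<open>lfp f\<close>, this
  is the case iff \<open>x \<lless> lfp f\<close>.
\<close>

definition degree :: "('a::complete_lattice \<Rightarrow> 'a) \<Rightarrow> 'a \<Rightarrow> 'o::wellorder" where
  "degree f x = (LEAST i. x \<lless> kleene f i)"


section \<open>Primal witnesses\<close>

definition primal_witness ::
    "('l::complete_lattice \<Rightarrow> 'b::complete_lattice) \<Rightarrow> ('l \<Rightarrow> 'l) \<Rightarrow> 'b \<Rightarrow> 'l \<Rightarrow> bool" where
  "primal_witness \<alpha> lam b a \<longleftrightarrow> a \<lless> lfp lam \<and> b \<lless> \<alpha> a"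

text \<open>
  \<open>choosable \<alpha> lam JL JB b A\<close>: the pair \<open>(b, A)\<close> is in the domain of the choice function \<open>P\<close>;
  \<open>candidates \<alpha> lam JL b A\<close>: the elements among which \<open>P b A\<close> is chosen.
\<close>

definition choosable ::
    "('l::complete_lattice \<Rightarrow> 'b::complete_lattice) \<Rightarrow> ('l \<Rightarrow> 'l) \<Rightarrow> 'l set \<Rightarrow> 'b set \<Rightarrow>
      'b \<Rightarrow> 'l set \<Rightarrow> bool" where
  "choosable \<alpha> lam JL JB b A \<longleftrightarrow>
     b \<in> JB \<and> finite A \<and> A \<subseteq> JL \<and> b \<lless> \<alpha> (lam (Sup A))"

definition candidates ::
    "('l::complete_lattice \<Rightarrow> 'b::complete_lattice) \<Rightarrow> ('l \<Rightarrow> 'l) \<Rightarrow> 'l set \<Rightarrow>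
      'b \<Rightarrow> 'l set \<Rightarrow> 'l set" where
  "candidates \<alpha> lam JL b A = {a \<in> JL. a \<lless> lam (Sup A) \<and> b \<lless> \<alpha> a}"

text \<open>
  The recursion takes place on \<open>D = {b \<in> JB. b \<lless> lfp \<beta>}\<close>; values outside \<open>D\<close> are irrelevant.
\<close>

definition wit_recursion ::
    "('b \<Rightarrow> 'l set \<Rightarrow> 'l) \<Rightarrow> ('b \<Rightarrow> 'b set) \<Rightarrow> 'b set \<Rightarrow> ('b \<Rightarrow> 'l) \<Rightarrow> bool" where
  "wit_recursion P S D wit \<longleftrightarrow> (\<forall>b\<in>D. wit b = P b {wit b' | b'. b' \<in> S b})"

end

theory Submission
  imports Defs
begin

text \<open>
  Both the recursion and the bound on degrees go by induction on \<open>deg\<^sub>\<beta> b\<close>. If \<open>A\<close> collects the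
  witnesses of \<open>S b\<close>, then \<open>Sup (S b) \<le> \<alpha> (Sup A)\<close>, hence
  \<open>b \<lless> \<beta> (Sup (S b)) \<le> \<beta> (\<alpha> (Sup A)) = \<alpha> (\<lambda> (Sup A))\<close>, so the choice function applies. A suitable
  element exists since \<open>\<alpha>\<close> preserves joins: approximate \<open>\<lambda> (Sup A)\<close> first by a directed set of
  elements way below it and then by finite joins of basis elements, of which irreducibility of \<open>b\<close>
  selects one. As \<open>S b\<close> is finite, all witnesses in \<open>A\<close> lie below one iterate
  \<open>\<lambda>\<^sup>j(\<bottom>)\<close> with \<open>j < deg\<^sub>\<beta> b\<close>, so that \<open>\<lambda> (Sup A)\<close> lies below the iterate at \<open>deg\<^sub>\<beta> b\<close>.
\<close>

section \<open>The way-below relation\<close>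

lemma way_below_imp_le: "x \<lless> y \<Longrightarrow> x \<le> y"
  unfolding way_below_def directed_def by (drule spec[of _ "{y}"]) auto

lemma way_below_trans_le: "x \<lless> y \<Longrightarrow> y \<le> z \<Longrightarrow> x \<lless> z"
  unfolding way_below_def by (meson order_trans)

lemma le_trans_way_below: "x \<le> y \<Longrightarrow> y \<lless> z \<Longrightarrow> x \<lless> z"
  unfolding way_below_def by (meson order_trans)

lemma bot_way_below: "bot \<lless> x"
  unfolding way_below_def directed_def by auto

lemma sup_way_below:
  assumes "x \<lless> z" and "y \<lless> z"
  shows "sup x y \<lless> z"
  unfolding way_below_def
proof (intro allI impI)
  fix D assume D: "directed D" "z \<le> Sup D"
  then obtain d e where "d \<in> D" "x \<le> d" "e \<in> D" "y \<le> e"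
    using assms unfolding way_below_def by blast
  moreover from this D obtain c where "c \<in> D" "d \<le> c" "e \<le> c"
    unfolding directed_def by blast
  ultimately show "\<exists>c\<in>D. sup x y \<le> c"
    by (meson le_supI order_trans)
qed

lemma directed_way_below: "directed {y. y \<lless> x}"
  unfolding directed_def
proof (intro conjI ballI)
  show "{y. y \<lless> x} \<noteq> {}"
    using bot_way_below by blast
  fix y z assume "y \<in> {y. y \<lless> x}" "z \<in> {y. y \<lless> x}"
  then show "\<exists>u\<in>{y. y \<lless> x}. y \<le> u \<and> z \<le> u"
    by (intro bexI[of _ "sup y z"]) (simp_all add: sup_way_below)
qed

lemma directed_image_mono:
  assumes "mono f" and "directed D"
  shows "directed (f ` D)"
  using assms unfolding directed_def mono_def by (simp, blast)

text \<open>This is where interpolation enters. By continuity, the elements way below some member of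
  \<open>D\<close> have join at least \<open>Sup D\<close>, and they form a directed set, so
  \<open>b\<close> lies below one of them and is thus way below a member of
  \<open>D\<close>.\<close>

lemma way_below_directed_Sup:
  fixes b :: "'a::continuous_lattice"
  assumes b: "b \<lless> Sup D" and D: "directed D"
  shows "\<exists>d\<in>D. b \<lless> d"
proof -
  let ?E = "{y. \<exists>d\<in>D. y \<lless> d}"
  have "directed ?E"
    unfolding directed_def
  proof (intro conjI ballI)
    show "?E \<noteq> {}"
      using D bot_way_below unfolding directed_def by blast
    fix x y assume "x \<in> ?E" "y \<in> ?E"
    then obtain d e where "d \<in> D" "x \<lless> d" "e \<in> D" "y \<lless> e" by blast
    moreover from this D obtain c where "c \<in> D" "d \<le> c" "e \<le> c"
      unfolding directed_def by blast
    ultimately have "sup x y \<in> ?E"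
      by (blast intro: sup_way_below way_below_trans_le)
    then show "\<exists>z\<in>?E. x \<le> z \<and> y \<le> z"
      using sup_ge1 sup_ge2 by blast
  qed
  moreover have "Sup D \<le> Sup ?E"
  proof (rule Sup_least)
    fix d assume "d \<in> D"
    then have "Sup {y. y \<lless> d} \<le> Sup ?E"
      by (intro Sup_subset_mono) blast
    then show "d \<le> Sup ?E"
      using Sup_way_below[of d] by simp
  qed
  ultimately obtain y d where "b \<le> y" "d \<in> D" "y \<lless> d"
    using b unfolding way_below_def by blast
  then show ?thesis
    using le_trans_way_below by blast
qed

text \<open>The joins of finite subsets of \<open>X\<close> form a directed set whose join is at
  least \<open>Sup X\<close>, which reduces the claim to the directed case.\<close>

lemma way_below_Sup_finite:
  fixes b :: "'a::continuous_lattice"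
  assumes "b \<lless> Sup X"
  shows "\<exists>F. finite F \<and> F \<subseteq> X \<and> b \<lless> Sup F"
proof -
  let ?D = "Sup ` {F. finite F \<and> F \<subseteq> X}"
  have "directed ?D"
    unfolding directed_def
  proof (intro conjI ballI)
    fix x y assume "x \<in> ?D" "y \<in> ?D"
    then obtain F G where "finite F" "F \<subseteq> X" "x = Sup F" "finite G" "G \<subseteq> X" "y = Sup G"
      by blast
    then show "\<exists>z\<in>?D. x \<le> z \<and> y \<le> z"
      by (intro bexI[of _ "Sup (F \<union> G)"]) (auto intro: Sup_subset_mono)
  qed auto
  moreover have "Sup X \<le> Sup ?D"
  proof (rule Sup_least)
    fix x assume "x \<in> X"
    then have "Sup {x} \<in> ?D" by blast
    then show "x \<le> Sup ?D" by (simp add: Sup_upper)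
  qed
  ultimately show ?thesis
    using way_below_directed_Sup[of b ?D] way_below_trans_le[OF assms] by blast
qed

section \<open>Existence of candidates for the choice function\<close>

lemma galois_connection_Sup:
  fixes \<alpha> :: "'l::complete_lattice \<Rightarrow> 'b::complete_lattice"
  assumes "galois_connection \<alpha> \<gamma>"
  shows "\<alpha> (Sup X) = Sup (\<alpha> ` X)"
proof (rule antisym)
  have \<alpha>: "mono \<alpha>" and \<gamma>: "mono \<gamma>" and unit: "\<And>l. l \<le> \<gamma> (\<alpha> l)" and counit: "\<And>d. \<alpha> (\<gamma> d) \<le> d"
    using assms by (auto simp: galois_connection_def)
  have "Sup X \<le> \<gamma> (Sup (\<alpha> ` X))"
    by (rule Sup_least) (metis SUP_upper monoD[OF \<gamma>] order_trans unit)
  then show "\<alpha> (Sup X) \<le> Sup (\<alpha> ` X)"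
    by (meson \<alpha> counit monoD order_trans)
  show "Sup (\<alpha> ` X) \<le> \<alpha> (Sup X)"
    using \<alpha> by (simp add: SUP_least Sup_upper monoD)
qed

lemma ex_basis_way_below:
  fixes \<alpha> :: "'l::continuous_lattice \<Rightarrow> 'b::continuous_lattice"
  assumes J: "join_basis J" and galois: "galois_connection \<alpha> \<gamma>"
    and irred: "way_below_irreducible b" and b: "b \<lless> \<alpha> x"
  shows "\<exists>a\<in>J. a \<lless> x \<and> b \<lless> \<alpha> a"
proof -
  have "mono \<alpha>"
    using galois by (simp add: galois_connection_def)
  have "\<alpha> x = Sup (\<alpha> ` {y. y \<lless> x})"
    using Sup_way_below[of x] galois_connection_Sup[OF galois] by metis
  \<comment> \<open>The detour through \<open>y\<close> secures \<open>a \<lless> x\<close> at the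
    end: basis elements obtained from a join basis are only known to satisfy
    \<open>a \<le> y\<close>, and \<open>y \<lless> x\<close> makes up for this.\<close>
  then obtain y where y: "y \<lless> x" "b \<lless> \<alpha> y"
    using way_below_directed_Sup[OF _ directed_image_mono[OF \<open>mono \<alpha>\<close> directed_way_below]] b
    by fastforce
  have "y = Sup {a \<in> J. a \<le> y}"
    using J unfolding join_basis_def by blast
  then have "\<alpha> y = Sup (\<alpha> ` {a \<in> J. a \<le> y})"
    using galois_connection_Sup[OF galois] by metis
  then obtain F where F: "finite F" "F \<subseteq> \<alpha> ` {a \<in> J. a \<le> y}" "b \<lless> Sup F"
    using way_below_Sup_finite[of b "\<alpha> ` {a \<in> J. a \<le> y}"] y(2) by auto
  then obtain f where "f \<in> F" "b \<lless> f"
    using irred unfolding way_below_irreducible_def by blast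
  with F obtain a where "a \<in> J" "a \<le> y" "b \<lless> \<alpha> a"
    by blast
  then show ?thesis
    using y le_trans_way_below by blast
qed

section \<open>Kleene iterates and degrees\<close>

lemma kleene_mono:
  assumes "mono f" and "i \<le> j"
  shows "kleene f i \<le> kleene f j"
proof (cases "i = j")
  case False
  then have "f (kleene f i) \<le> kleene f j"
    using kleene_increasing[OF assms(1), of j] assms(2) by simp
  then show ?thesis
    using kleene_increasing[OF assms(1), of i] order_trans by blast
qed simp

lemma way_below_kleene_degree:
  assumes "x \<lless> kleene f (i :: 'o::wellorder)"
  shows "x \<lless> kleene f (degree f x :: 'o)"
  unfolding degree_def using assms by (rule LeastI)

lemma degree_le: "x \<lless> kleene f i \<Longrightarrow> degree f x \<le> i"
  unfolding degree_def by (rule Least_le)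

text \<open>At the least ordinal the iterate is an empty join, hence \<open>bot\<close>. This makes
  the degree positive in the base case of the recursion.\<close>

lemma way_below_kleene_nonzero:
  assumes "b \<lless> kleene f i" and "b \<noteq> bot"
  shows "\<exists>j. j < i"
proof (rule ccontr)
  assume no: "\<nexists>j. j < i"
  then have "kleene f i = bot"
    using kleene_limit[of i f] by (auto simp: is_succ_def)
  with assms show False
    using way_below_imp_le bot_unique by metis
qed

theorem theorem18:
  fixes JL :: "'l::continuous_lattice set" and JB :: "'b::continuous_lattice set"
    and \<alpha> :: "'l \<Rightarrow> 'b" and \<gamma> :: "'b \<Rightarrow> 'l"
    and lam :: "'l \<Rightarrow> 'l" and \<beta> :: "'b \<Rightarrow> 'b"
    and S :: "'b \<Rightarrow> 'b set"
  assumes "join_basis JL" and "bot \<notin> JL"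
    and "join_basis JB" and "bot \<notin> JB"
    and "\<forall>b\<in>JB. way_below_irreducible b"
    and "galois_connection \<alpha> \<gamma>"
    and "mono lam" and "mono \<beta>"
    and "\<alpha> \<circ> lam = \<beta> \<circ> \<alpha>"
    and "scott_continuous \<beta>"
    and strategy: "\<forall>b\<in>JB. b \<lless> lfp \<beta> \<longrightarrow>
      finite (S b) \<and> S b \<subseteq> JB \<and> b \<lless> \<beta> (Sup (S b)) \<and>
      (\<forall>b'\<in>S b. b' \<lless> lfp \<beta> \<and>
         (degree \<beta> b' :: ('l, 'b) iteration_ordinal) < degree \<beta> b)"
  shows "(\<forall>b A. choosable \<alpha> lam JL JB b A \<longrightarrow> candidates \<alpha> lam JL b A \<noteq> {}) \<and>
    (\<forall>P. (\<forall>b A. choosable \<alpha> lam JL JB b A \<longrightarrow> P b A \<in> candidates \<alpha> lam JL b A) \<longrightarrow>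
      (let D = {b \<in> JB. b \<lless> lfp \<beta>} in
        wf {(b', b). b \<in> D \<and> b' \<in> S b} \<and>
        (\<exists>wit. wit_recursion P S D wit \<and>
          (\<forall>wit'. wit_recursion P S D wit' \<longrightarrow> (\<forall>b\<in>D. wit' b = wit b))) \<and>
        (\<forall>wit. wit_recursion P S D wit \<longrightarrow>
          (\<forall>b\<in>D.
            (S b = {} \<longrightarrow> wit b = P b {}) \<and>
            S b \<subseteq> D \<and>
            choosable \<alpha> lam JL JB b {wit b' | b'. b' \<in> S b} \<and>
            wit b \<in> JL \<and>
            primal_witness \<alpha> lam b (wit b) \<and>
            (degree lam (wit b) :: ('l, 'b) iteration_ordinal) \<le> degree \<beta> b))))"
proof (intro conjI allI impI)
  fix b A
  assume "choosable \<alpha> lam JL JB b A"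
  then show "candidates \<alpha> lam JL b A \<noteq> {}"
    using ex_basis_way_below[of JL \<alpha> \<gamma> b "lam (Sup A)"] assms
    by (auto simp: choosable_def candidates_def)
next
  fix P
  assume P: "\<forall>b A. choosable \<alpha> lam JL JB b A \<longrightarrow> P b A \<in> candidates \<alpha> lam JL b A"
  define D where "D = {b \<in> JB. b \<lless> lfp \<beta>}"
  define R where "R = {(b', b). b \<in> D \<and> b' \<in> S b}"
  define deg :: "'b \<Rightarrow> ('l, 'b) iteration_ordinal" where "deg = degree \<beta>"
  have finite_S: "finite (S b)" and S_subset: "S b \<subseteq> D" and way_below_S: "b \<lless> \<beta> (Sup (S b))"
    and deg_S: "\<And>b'. b' \<in> S b \<Longrightarrow> deg b' < deg b" if "b \<in> D" for b
    using strategy that unfolding D_def deg_def by auto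
  \<comment> \<open>Every pair in \<open>R\<close> strictly lowers \<open>deg\<close>, so
    well-foundedness is inherited from the ordinals.\<close>
  have "wf (inv_image {(i, j). i < j} deg)"
    by (intro wf_inv_image wf)
  then have wf_R: "wf R"
    by (rule wf_subset) (auto simp: R_def deg_S)
  define w where "w = wfrec R (\<lambda>f b. P b {f b' | b'. b' \<in> S b})"
  have rec_w: "wit_recursion P S D w"
    unfolding wit_recursion_def
  proof
    fix b assume "b \<in> D"
    \<comment> \<open>The truncation made by \<open>wfrec\<close> is harmless: recursive calls occur
      only at elements of \<open>S b\<close>, all related to \<open>b\<close> by
      \<open>R\<close>.\<close>
    then have "{cut w R b b' | b'. b' \<in> S b} = {w b' | b'. b' \<in> S b}"
      by (auto simp: cut_def R_def)
    then show "w b = P b {w b' | b'. b' \<in> S b}"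
      using wfrec[OF wf_R, of "\<lambda>f b. P b {f b' | b'. b' \<in> S b}" b] unfolding w_def by simp
  qed
  have unique: "wit b = w b" if rec: "wit_recursion P S D wit" and "b \<in> D" for wit b
    using wf_R \<open>b \<in> D\<close>
  proof (induction b rule: wf_induct_rule)
    case (less b)
    then have "wit b' = w b'" if "b' \<in> S b" for b'
      using that S_subset by (auto simp: R_def)
    then have "{wit b' | b'. b' \<in> S b} = {w b' | b'. b' \<in> S b}"
      by force
    then show ?case
      using less.prems rec rec_w unfolding wit_recursion_def by simp
  qed
  \<comment> \<open>The degree bound is carried as \<open>\<lless>\<close> at the iterate
    \<open>deg b\<close>: as a \<open>LEAST\<close>, \<open>degree\<close> alone would not tell that
    this iterate is attained. Both the witness property and the bound follow from it.\<close>
  have *: "choosable \<alpha> lam JL JB b {wit b' | b'. b' \<in> S b} \<and> wit b \<in> JL \<and>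
      b \<lless> \<alpha> (wit b) \<and> wit b \<lless> kleene lam (deg b)"
    if rec: "wit_recursion P S D wit" and "b \<in> D" for wit b
    using wf_R \<open>b \<in> D\<close>
  proof (induction b rule: wf_induct_rule)
    case (less b)
    let ?A = "{wit b' | b'. b' \<in> S b}"
    have IH: "wit b' \<in> JL" "b' \<lless> \<alpha> (wit b')" "wit b' \<lless> kleene lam (deg b')" if "b' \<in> S b" for b'
      using less that S_subset by (auto simp: R_def)
    have "mono \<alpha>"
      using assms(6) by (simp add: galois_connection_def)
    have "Sup (S b) \<le> \<alpha> (Sup ?A)"
    proof (rule Sup_least)
      fix b' assume b': "b' \<in> S b"
      then have "wit b' \<le> Sup ?A"
        by (blast intro: Sup_upper)
      then show "b' \<le> \<alpha> (Sup ?A)"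
        using way_below_imp_le[OF IH(2)[OF b']] monoD[OF \<open>mono \<alpha>\<close>] order_trans by blast
    qed
    then have "\<beta> (Sup (S b)) \<le> \<alpha> (lam (Sup ?A))"
      using monoD[OF assms(8)] fun_cong[OF assms(9), of "Sup ?A"] by simp
    then have choosable: "choosable \<alpha> lam JL JB b ?A"
      using way_below_S[OF less.prems] finite_S[OF less.prems] less.prems IH(1)
      by (auto simp: choosable_def D_def intro: way_below_trans_le)
    then have wit_b: "wit b \<in> JL" "wit b \<lless> lam (Sup ?A)" "b \<lless> \<alpha> (wit b)"
      using P rec less.prems by (auto simp: wit_recursion_def candidates_def)
    \<comment> \<open>Strictness of \<open>j < deg b\<close> leaves room for the application of
      \<open>lam\<close>. For empty \<open>S b\<close> there is no maximum to take, and any ordinal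
      below \<open>deg b\<close> will do.\<close>
    have "\<exists>j<deg b. \<forall>b'\<in>S b. deg b' \<le> j"
    proof (cases "S b = {}")
      case True
      \<comment> \<open>The iteration reaches \<open>lfp \<beta>\<close>, so the degree of
        \<open>b\<close> is attained; it is then positive because \<open>bot\<close> is not in
        \<open>JB\<close>.\<close>
      obtain i :: "('l, 'b) iteration_ordinal" where "kleene \<beta> i = lfp \<beta>"
        using kleene_iteration_ordinal(2)[OF assms(7,8)] by blast
      then have "b \<lless> kleene \<beta> (deg b)"
        using less.prems way_below_kleene_degree[of b \<beta> i] by (simp add: D_def deg_def)
      moreover have "b \<noteq> bot"
        using less.prems assms(4) by (auto simp: D_def)
      ultimately show ?thesis
        using way_below_kleene_nonzero True by blast
    next
      case False
      then show ?thesis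
        using finite_S[OF less.prems] deg_S[OF less.prems]
        by (intro exI[of _ "Max (deg ` S b)"]) auto
    qed
    then obtain j where j: "j < deg b" "\<And>b'. b' \<in> S b \<Longrightarrow> deg b' \<le> j"
      by blast
    have "Sup ?A \<le> kleene lam j"
    proof (rule Sup_least)
      fix a assume "a \<in> ?A"
      then obtain b' where b': "b' \<in> S b" "a = wit b'" by blast
      then have "a \<le> kleene lam (deg b')"
        using way_below_imp_le[OF IH(3)] by simp
      also have "\<dots> \<le> kleene lam j"
        using assms(7) j(2) b' by (intro kleene_mono)
      finally show "a \<le> kleene lam j" .
    qed
    then have "lam (Sup ?A) \<le> lam (kleene lam j)"
      by (rule monoD[OF assms(7)])
    \<comment> \<open>This holds for limit and successor \<open>deg b\<close> alike.\<close>
    also have "\<dots> \<le> kleene lam (deg b)"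
      using kleene_increasing[OF assms(7)] j(1) by blast
    finally have "lam (Sup ?A) \<le> kleene lam (deg b)" .
    then show ?case
      using choosable wit_b way_below_trans_le by blast
  qed
  have "primal_witness \<alpha> lam b (wit b) \<and> degree lam (wit b) \<le> deg b"
    if "wit_recursion P S D wit" and "b \<in> D" for wit b
    unfolding primal_witness_def
    using *[OF that] way_below_trans_le kleene_le_lfp[OF assms(7)] degree_le by blast
  moreover have "S b = {} \<longrightarrow> wit b = P b {}"
    if "wit_recursion P S D wit" and "b \<in> D" for wit b
    using that by (auto simp: wit_recursion_def)
  ultimately show "let D = {b \<in> JB. b \<lless> lfp \<beta>} in
      wf {(b', b). b \<in> D \<and> b' \<in> S b} \<and>
      (\<exists>wit. wit_recursion P S D wit \<and>
        (\<forall>wit'. wit_recursion P S D wit' \<longrightarrow> (\<forall>b\<in>D. wit' b = wit b))) \<and>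
      (\<forall>wit. wit_recursion P S D wit \<longrightarrow>
        (\<forall>b\<in>D.
          (S b = {} \<longrightarrow> wit b = P b {}) \<and>
          S b \<subseteq> D \<and>
          choosable \<alpha> lam JL JB b {wit b' | b'. b' \<in> S b} \<and>
          wit b \<in> JL \<and>
          primal_witness \<alpha> lam b (wit b) \<and>
          (degree lam (wit b) :: ('l, 'b) iteration_ordinal) \<le> degree \<beta> b))"
    unfolding Let_def D_def[symmetric] R_def[symmetric] deg_def[symmetric]
    using wf_R rec_w unique S_subset * by blast
qed

end
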